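(* Let $p$ be a prime, $S$ a finite $p$-group and $G$ a finite group satisfying: (a) $S$ is a Sylow $p$-subgroup of $G$; (b) $C_G(O_p(G))\leq O_p(G)$; (c) $G$ acts (by conjugation) $p$-stably on every normal $p$-subgroup of $G$. Let $\mathcal{A}$ be a set of abelian subgroups of $S$ with the following two properties: (invariance in $S$, for $G$) for every $P\trianglelefteq S$, the subgroup $I_{\mathcal{A}|P}$ is invariant under (conjugation by) $N_G(P)$; (replacement in $S$) for every $B\trianglelefteq S$ of nilpotency class $\leq 2$, if there exist members of $\mathcal{A}$ that contain $[B,B]$ but do not contain $B$, then $B$ normalizes one of them (that is, $B$ normalizes some member of $\mathcal{A}$ that contains $[B,B]$ but not $B$). Then $I_{\mathcal{A}}\trianglelefteq G$. Furthermore, if $I_{\mathcal{A}}$ is characteristic in $S$, then $I_{\mathcal{A}}$ is characteristic in $G$.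
   Context: All groups are finite. For a set $\mathcal{A}$ of abelian subgroups of a $p$-group $S$, $I_{\mathcal{A}}:=\bigcap_{A\in\mathcal{A}}A$, with the convention $I_{\mathcal{A}}=1$ if $\mathcal{A}=\emptyset$. For $P\leq S$, $\mathcal{A}|_P:=\{A\in\mathcal{A}: A\leq P\}$ and $I_{\mathcal{A}|P}:=I_{\mathcal{A}|_P}$ (so it is $1$ if $\mathcal{A}|_P$ is empty). $O_p(G)$ is the largest normal $p$-subgroup of $G$. If $G$ acts on a $p$-group $P$, then $O_p(G\curvearrowright P)\trianglelefteq G$ denotes the preimage of $O_p(G/C_G(P))$ under the natural map $G\to G/C_G(P)$. An element $x\in G$ acts quadratically on $P$ if $[P,x,x]=1$, where brackets nest to the left, $[P,x,x]=[[P,x],x]$, and commutators are $[w,x]=w^{-1}x^{-1}wx$ (in $P\rtimes G$). The action of $G$ on $P$ is called $p$-stable if every element of $G$ that acts quadratically on $P$ lies in $O_p(G\curvearrowright P)$. *)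

theory Defs
  imports
    "HOL-Algebra.Sylow"
    "HOL-Algebra.Bij"
    "HOL-Algebra.Generated_Groups"
    "HOL-Algebra.Group_Action"
    "HOL-Algebra.SndIsomorphismGrp"
    "HOL-Computational_Algebra.Primes"
begin

text \<open>A subgroup \<open>H\<close> of \<open>G\<close>, regarded as a group, is \<open>G\<lparr>carrier := H\<rparr>\<close>.\<close>

section \<open>\<open>p\<close>-groups, Sylow subgroups and the \<open>p\<close>-core\<close>

text \<open>For \<open>p > 0\<close> the condition on the order forces finiteness, as infinite sets have
  cardinality \<open>0\<close>.\<close>

definition p_group :: "nat \<Rightarrow> ('a, 'b) monoid_scheme \<Rightarrow> bool" where
  "p_group p G \<longleftrightarrow> group G \<and> (\<exists>n. order G = p ^ n)"

definition sylow_subgroup :: "nat \<Rightarrow> 'a set \<Rightarrow> ('a, 'b) monoid_scheme \<Rightarrow> bool" where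
  "sylow_subgroup p S G \<longleftrightarrow> subgroup S G \<and> card S = p ^ multiplicity p (order G)"

definition normal_p_subgroup :: "nat \<Rightarrow> 'a set \<Rightarrow> ('a, 'b) monoid_scheme \<Rightarrow> bool" where
  "normal_p_subgroup p N G \<longleftrightarrow> N \<lhd> G \<and> p_group p (G\<lparr>carrier := N\<rparr>)"

text \<open>\<open>O\<^sub>p(G)\<close>, the largest normal \<open>p\<close>-subgroup with respect to inclusion; it exists for
  finite \<open>G\<close> by \<open>p_core_greatest\<close> below.\<close>

definition p_core :: "nat \<Rightarrow> ('a, 'b) monoid_scheme \<Rightarrow> 'a set" where
  "p_core p G = (GREATEST N. normal_p_subgroup p N G)"

definition centralizer :: "('a, 'b) monoid_scheme \<Rightarrow> 'a set \<Rightarrow> 'a set" where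
  "centralizer G H = {g \<in> carrier G. \<forall>h\<in>H. g \<otimes>\<^bsub>G\<^esub> h = h \<otimes>\<^bsub>G\<^esub> g}"

definition characteristic :: "'a set \<Rightarrow> ('a, 'b) monoid_scheme \<Rightarrow> bool" where
  "characteristic H G \<longleftrightarrow> subgroup H G \<and> (\<forall>\<alpha> \<in> auto G. \<alpha> ` H = H)"


section \<open>Nilpotency class\<close>

definition commutator_subgroup :: "('a, 'b) monoid_scheme \<Rightarrow> 'a set \<Rightarrow> 'a set \<Rightarrow> 'a set" where
  "commutator_subgroup G H K =
     generate G {inv\<^bsub>G\<^esub> h \<otimes>\<^bsub>G\<^esub> inv\<^bsub>G\<^esub> k \<otimes>\<^bsub>G\<^esub> h \<otimes>\<^bsub>G\<^esub> k | h k. h \<in> H \<and> k \<in> K}"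

text \<open>Indexed from \<open>0\<close>: \<open>lower_central G n\<close> is what is usually written \<open>\<gamma>\<^sub>n\<^sub>+\<^sub>1(G)\<close>.\<close>

fun lower_central :: "('a, 'b) monoid_scheme \<Rightarrow> nat \<Rightarrow> 'a set" where
  "lower_central G 0 = carrier G"
| "lower_central G (Suc n) = commutator_subgroup G (lower_central G n) (carrier G)"

definition nilpotency_class_le :: "('a, 'b) monoid_scheme \<Rightarrow> nat \<Rightarrow> bool" where
  "nilpotency_class_le G c \<longleftrightarrow> lower_central G c = {\<one>\<^bsub>G\<^esub>}"


section \<open>\<open>p\<close>-stable actions\<close>

text \<open>An action of a group \<open>G\<close> on a group \<open>P\<close> by automorphisms is a homomorphism \<open>\<phi>\<close> from \<open>G\<close>
  to \<open>AutoGroup P\<close>. These are left actions, so in the semidirect product of \<open>P\<close> with \<open>G\<close> one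
  has \<open>x\<^sup>-\<^sup>1 w x = \<phi> (x\<^sup>-\<^sup>1) w\<close>, and \<open>action_commutator G P \<phi> w x\<close> is
  \<open>[w,x] = w\<^sup>-\<^sup>1 x\<^sup>-\<^sup>1 w x\<close>.\<close>

definition action_commutator ::
    "('a, 'b) monoid_scheme \<Rightarrow> ('c, 'd) monoid_scheme \<Rightarrow> ('a \<Rightarrow> 'c \<Rightarrow> 'c) \<Rightarrow> 'c \<Rightarrow> 'a \<Rightarrow> 'c" where
  "action_commutator G P \<phi> w x = inv\<^bsub>P\<^esub> w \<otimes>\<^bsub>P\<^esub> \<phi> (inv\<^bsub>G\<^esub> x) w"

definition action_commutator_subgroup ::
    "('a, 'b) monoid_scheme \<Rightarrow> ('c, 'd) monoid_scheme \<Rightarrow> ('a \<Rightarrow> 'c \<Rightarrow> 'c) \<Rightarrow> 'c set \<Rightarrow> 'a \<Rightarrow> 'c set" where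
  "action_commutator_subgroup G P \<phi> Q x =
     generate P {action_commutator G P \<phi> w x | w. w \<in> Q}"

definition acts_quadratically ::
    "('a, 'b) monoid_scheme \<Rightarrow> ('c, 'd) monoid_scheme \<Rightarrow> ('a \<Rightarrow> 'c \<Rightarrow> 'c) \<Rightarrow> 'a \<Rightarrow> bool" where
  "acts_quadratically G P \<phi> x \<longleftrightarrow>
     action_commutator_subgroup G P \<phi> (action_commutator_subgroup G P \<phi> (carrier P) x) x
       = {\<one>\<^bsub>P\<^esub>}"

definition action_centralizer ::
    "('a, 'b) monoid_scheme \<Rightarrow> ('c, 'd) monoid_scheme \<Rightarrow> ('a \<Rightarrow> 'c \<Rightarrow> 'c) \<Rightarrow> 'a set" where
  "action_centralizer G P \<phi> = {g \<in> carrier G. \<forall>w \<in> carrier P. \<phi> g w = w}"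

definition action_p_core ::
    "nat \<Rightarrow> ('a, 'b) monoid_scheme \<Rightarrow> ('c, 'd) monoid_scheme \<Rightarrow> ('a \<Rightarrow> 'c \<Rightarrow> 'c) \<Rightarrow> 'a set" where
  "action_p_core p G P \<phi> =
     {g \<in> carrier G. action_centralizer G P \<phi> #>\<^bsub>G\<^esub> g
                       \<in> p_core p (G Mod action_centralizer G P \<phi>)}"

definition p_stable_action ::
    "nat \<Rightarrow> ('a, 'b) monoid_scheme \<Rightarrow> ('c, 'd) monoid_scheme \<Rightarrow> ('a \<Rightarrow> 'c \<Rightarrow> 'c) \<Rightarrow> bool" where
  "p_stable_action p G P \<phi> \<longleftrightarrow>
     (\<forall>x \<in> carrier G. acts_quadratically G P \<phi> x \<longrightarrow> x \<in> action_p_core p G P \<phi>)"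

text \<open>The restriction to \<open>P\<close> is there because the elements of \<open>auto\<close> are extensional.\<close>

definition conj_action :: "('a, 'b) monoid_scheme \<Rightarrow> 'a set \<Rightarrow> 'a \<Rightarrow> 'a \<Rightarrow> 'a" where
  "conj_action G P = (\<lambda>g. \<lambda>w\<in>P. g \<otimes>\<^bsub>G\<^esub> w \<otimes>\<^bsub>G\<^esub> inv\<^bsub>G\<^esub> g)"


section \<open>Sets of abelian subgroups\<close>

text \<open>\<open>I\<^sub>\<A>\<close>; the trivial subgroup if \<open>\<A>\<close> is empty.\<close>

definition fam_Inter :: "('a, 'b) monoid_scheme \<Rightarrow> 'a set set \<Rightarrow> 'a set" where
  "fam_Inter G \<A> = (if \<A> = {} then {\<one>\<^bsub>G\<^esub>} else \<Inter>\<A>)"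

definition fam_restrict :: "'a set set \<Rightarrow> 'a set \<Rightarrow> 'a set set" where
  "fam_restrict \<A> P = {A \<in> \<A>. A \<subseteq> P}"

definition abelian_subgroups_of :: "('a, 'b) monoid_scheme \<Rightarrow> 'a set \<Rightarrow> 'a set set \<Rightarrow> bool" where
  "abelian_subgroups_of G S \<A> \<longleftrightarrow>
     (\<forall>A\<in>\<A>. subgroup A (G\<lparr>carrier := S\<rparr>) \<and> comm_group (G\<lparr>carrier := A\<rparr>))"

definition invariance_property :: "('a, 'b) monoid_scheme \<Rightarrow> 'a set \<Rightarrow> 'a set set \<Rightarrow> bool" where
  "invariance_property G S \<A> \<longleftrightarrow>
     (\<forall>P. P \<lhd> G\<lparr>carrier := S\<rparr> \<longrightarrow>
        (\<forall>g \<in> normalizer G P.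
           g <#\<^bsub>G\<^esub> fam_Inter G (fam_restrict \<A> P) #>\<^bsub>G\<^esub> inv\<^bsub>G\<^esub> g
             = fam_Inter G (fam_restrict \<A> P)))"

definition replacement_property :: "('a, 'b) monoid_scheme \<Rightarrow> 'a set \<Rightarrow> 'a set set \<Rightarrow> bool" where
  "replacement_property G S \<A> \<longleftrightarrow>
     (\<forall>B. B \<lhd> G\<lparr>carrier := S\<rparr> \<and> nilpotency_class_le (G\<lparr>carrier := B\<rparr>) 2 \<and>
          (\<exists>A\<in>\<A>. derived G B \<subseteq> A \<and> \<not> B \<subseteq> A) \<longrightarrow>
        (\<exists>A\<in>\<A>. derived G B \<subseteq> A \<and> \<not> B \<subseteq> A \<and> B \<subseteq> normalizer G A))"


section \<open>Well-definedness\<close>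

lemma conj_action_hom:
  fixes G (structure)
  assumes "P \<lhd> G"
  shows "group_hom G (AutoGroup (G\<lparr>carrier := P\<rparr>)) (conj_action G P)"
proof -
  interpret normal P G by fact
  have clP: "g \<otimes> w \<otimes> inv g \<in> P" if "g \<in> carrier G" "w \<in> P" for g w
    using that inv_op_closed2 by blast
  have PG: "w \<in> carrier G" if "w \<in> P" for w
    using that by (rule mem_carrier)
  have comp: "conj_action G P (g \<otimes> h) w = conj_action G P g (conj_action G P h w)"
    if "g \<in> carrier G" "h \<in> carrier G" "w \<in> P" for g h w
    using that clP by (simp add: conj_action_def PG m_assoc inv_mult_group)
  have bij: "bij_betw (conj_action G P g) P P" if g: "g \<in> carrier G" for g
  proof (rule bij_betw_byWitness[where f' = "conj_action G P (inv g)"])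
    have one: "conj_action G P \<one> w = w" if "w \<in> P" for w
      using that by (simp add: conj_action_def PG)
    show "\<forall>w\<in>P. conj_action G P (inv g) (conj_action G P g w) = w"
      using g one comp[of "inv g" g] by simp
    show "\<forall>w\<in>P. conj_action G P g (conj_action G P (inv g) w) = w"
      using g one comp[of g "inv g"] by simp
  qed (use g clP clP[of "inv g"] in \<open>auto simp: conj_action_def\<close>)
  have hom: "conj_action G P g \<in> hom (G\<lparr>carrier := P\<rparr>) (G\<lparr>carrier := P\<rparr>)"
    if g: "g \<in> carrier G" for g
  proof (rule homI)
    fix v w assume "v \<in> carrier (G\<lparr>carrier := P\<rparr>)" "w \<in> carrier (G\<lparr>carrier := P\<rparr>)"
    hence vw: "v \<in> P" "w \<in> P" "v \<in> carrier G" "w \<in> carrier G" by (auto simp: PG)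
    have "inv g \<otimes> (g \<otimes> (w \<otimes> inv g)) = w \<otimes> inv g"
      using g vw by (simp flip: m_assoc)
    thus "conj_action G P g (v \<otimes>\<^bsub>G\<lparr>carrier := P\<rparr>\<^esub> w) =
          conj_action G P g v \<otimes>\<^bsub>G\<lparr>carrier := P\<rparr>\<^esub> conj_action G P g w"
      using g vw by (simp add: conj_action_def m_assoc)
  qed (use g clP in \<open>auto simp: conj_action_def\<close>)
  have auto: "conj_action G P g \<in> auto (G\<lparr>carrier := P\<rparr>)" if "g \<in> carrier G" for g
    using hom[OF that] bij[OF that] by (auto simp: auto_def Bij_def conj_action_def)
  have "conj_action G P \<in> hom G (AutoGroup (G\<lparr>carrier := P\<rparr>))"
  proof (rule homI)
    fix g h assume gh: "g \<in> carrier G" "h \<in> carrier G"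
    have "conj_action G P g \<in> Bij P" "conj_action G P h \<in> Bij P"
      using auto gh by (auto simp: auto_def)
    moreover have "conj_action G P (g \<otimes> h) =
        compose P (conj_action G P g) (conj_action G P h)"
      using gh comp by (auto simp: fun_eq_iff compose_def restrict_def)
        (simp add: conj_action_def)
    ultimately show "conj_action G P (g \<otimes> h) =
        conj_action G P g \<otimes>\<^bsub>AutoGroup (G\<lparr>carrier := P\<rparr>)\<^esub> conj_action G P h"
      by (simp add: AutoGroup_def BijGroup_def)
  qed (simp add: AutoGroup_def auto)
  moreover have "group (AutoGroup (G\<lparr>carrier := P\<rparr>))"
    using group.AutoGroup subgroup_is_group is_group by blast
  ultimately show ?thesis
    by (simp add: group_hom_def group_hom_axioms_def is_group)
qed

lemma normal_p_subgroup_set_mult: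
  assumes p: "Factorial_Ring.prime p" and fin: "finite (carrier G)"
    and M: "normal_p_subgroup p M G" and N: "normal_p_subgroup p N G"
  shows "normal_p_subgroup p (M <#>\<^bsub>G\<^esub> N) G"
proof -
  interpret M: normal M G using M by (simp add: normal_p_subgroup_def)
  interpret N: normal N G using N by (simp add: normal_p_subgroup_def)
  interpret I: second_isomorphism_grp M G N
    by unfold_locales
  let ?MN = "M <#>\<^bsub>G\<^esub> N"
  have sub: "subgroup ?MN G" by (rule I.normal_set_mult_subgroup)
  have nrm: "?MN \<lhd> G"
  proof (rule M.normal_invI[OF sub])
    fix x h assume x: "x \<in> carrier G" and "h \<in> ?MN"
    then obtain m n where mn: "m \<in> M" "n \<in> N" "h = m \<otimes>\<^bsub>G\<^esub> n"
      by (auto simp: set_mult_def)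
    let ?c = "\<lambda>h. x \<otimes>\<^bsub>G\<^esub> h \<otimes>\<^bsub>G\<^esub> inv\<^bsub>G\<^esub> x"
    have G: "m \<in> carrier G" "n \<in> carrier G" using mn by auto
    have "inv\<^bsub>G\<^esub> x \<otimes>\<^bsub>G\<^esub> (x \<otimes>\<^bsub>G\<^esub> (n \<otimes>\<^bsub>G\<^esub> inv\<^bsub>G\<^esub> x)) = n \<otimes>\<^bsub>G\<^esub> inv\<^bsub>G\<^esub> x"
      using x G by (simp flip: M.m_assoc)
    hence "?c h = ?c m \<otimes>\<^bsub>G\<^esub> ?c n"
      using x G mn by (simp add: M.m_assoc)
    moreover have "?c m \<in> M" "?c n \<in> N"
      using x mn M.inv_op_closed2 N.inv_op_closed2 by auto
    ultimately show "?c h \<in> ?MN" by (auto simp: set_mult_def)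
  qed
  obtain a b where ab: "card M = p ^ a" "card N = p ^ b"
    using M N by (auto simp: normal_p_subgroup_def p_group_def order_def)
  have gMN: "group (G\<lparr>carrier := ?MN\<rparr>)" and gN: "group (G\<lparr>carrier := N\<rparr>)"
    using sub M.subgroup_imp_group N.subgroup_axioms by auto
  have "M \<lhd> G\<lparr>carrier := ?MN\<rparr>"
    by (simp add: I.H_contained_in_set_mult M.normal_restrict_supergroup sub M.normal_axioms)
  hence 1: "order (G\<lparr>carrier := ?MN\<rparr> Mod M) * card M = card ?MN"
    using group.lagrange[OF gMN, of M]
    by (simp add: normal_def order_def FactGroup_def)
  have "M \<inter> N \<lhd> G\<lparr>carrier := N\<rparr>"
    using I.normal_subgrp_intersection_normal by (simp add: Int_commute)
  hence 2: "order (G\<lparr>carrier := N\<rparr> Mod (M \<inter> N)) * card (M \<inter> N) = card N"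
    using group.lagrange[OF gN, of "M \<inter> N"]
    by (simp add: normal_def order_def FactGroup_def)
  have 3: "order (G\<lparr>carrier := N\<rparr> Mod (M \<inter> N)) = order (G\<lparr>carrier := ?MN\<rparr> Mod M)"
    using I.normal_intersection_quotient_isom unfolding iso_def order_def
    by (auto dest: bij_betw_same_card)
  have "card ?MN dvd card N * card M"
    using 1 2 3 by (metis dvd_triv_left mult_dvd_mono dvd_refl)
  hence "card ?MN dvd p ^ (b + a)" by (simp add: ab power_add)
  then obtain c where "card ?MN = p ^ c"
    using p divides_primepow_nat by blast
  thus ?thesis
    using nrm gMN by (auto simp: normal_p_subgroup_def p_group_def order_def)
qed

lemma p_core_greatest:
  assumes p: "Factorial_Ring.prime p" and grp: "group G" and fin: "finite (carrier G)"
  shows "normal_p_subgroup p (p_core p G) G"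
    and "normal_p_subgroup p N G \<Longrightarrow> N \<subseteq> p_core p G"
proof -
  interpret group G by fact
  have "normal_p_subgroup p {\<one>\<^bsub>G\<^esub>} G"
    unfolding normal_p_subgroup_def p_group_def order_def
    using one_is_normal subgroup_imp_group[OF triv_subgroup]
    by (auto intro: exI[of _ 0])
  moreover have sub: "N \<subseteq> carrier G" if "normal_p_subgroup p N G" for N
    using that by (meson normal_p_subgroup_def normal_imp_subgroup subgroup.subset)
  hence "finite {N. normal_p_subgroup p N G}"
    using fin by (auto intro: finite_subset[of _ "Pow (carrier G)"])
  ultimately obtain M where M: "normal_p_subgroup p M G"
    and max: "\<And>N. normal_p_subgroup p N G \<Longrightarrow> M \<subseteq> N \<Longrightarrow> N = M"
    using finite_has_maximal[of "{N. normal_p_subgroup p N G}"] by blast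
  have great: "N \<subseteq> M" if N: "normal_p_subgroup p N G" for N
  proof -
    interpret M: normal M G using M by (simp add: normal_p_subgroup_def)
    interpret I: second_isomorphism_grp M G N
      using N
      by (simp add: second_isomorphism_grp_def second_isomorphism_grp_axioms_def
          M.normal_axioms normal_p_subgroup_def normal_imp_subgroup)
    show ?thesis
      using max[OF normal_p_subgroup_set_mult[OF p fin M N]]
        I.H_contained_in_set_mult I.S_contained_in_set_mult by auto
  qed
  have eq: "p_core p G = M"
    unfolding p_core_def using M great by (intro Greatest_equality) auto
  show "normal_p_subgroup p (p_core p G) G" using M by (simp add: eq)
  show "normal_p_subgroup p N G \<Longrightarrow> N \<subseteq> p_core p G" using great by (simp add: eq)
qed

end

theory Submission
  imports Defs
begin

text \<open>Assume \<open>\<A> \<noteq> {}\<close> and let \<open>I = \<Inter>\<A>\<close>. Then \<open>I\<close> is abelian and normal in \<open>S\<close>, hence acts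
  quadratically on \<open>O\<^sub>p(G)\<close>; by \<open>p\<close>-stability and \<open>C\<^sub>G(O\<^sub>p(G)) \<le> O\<^sub>p(G)\<close> it lies in \<open>O\<^sub>p(G)\<close>. So it
  suffices that \<open>I \<inter> B\<close> is normal in \<open>G\<close> for every normal \<open>p\<close>-subgroup \<open>B\<close>.

  In a minimal counterexample, every normal subgroup of \<open>G\<close> containing \<open>I \<inter> B\<close> contains \<open>B\<close>. Applied
  to the elements that commute with \<open>B\<close> modulo the normal subgroup \<open>I \<inter> [B,B]\<close>, this gives
  \<open>[B,B] \<le> I\<close>; applied to the centralizer of \<open>[B,B]\<close>, it gives that \<open>B\<close> has class at most \<open>2\<close>. As
  \<open>B\<close> is not contained in \<open>I\<close>, replacement yields \<open>A \<in> \<A>\<close> normalized by \<open>B\<close> and not containing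
  \<open>B\<close>. Then \<open>A\<close> acts quadratically on \<open>B\<close> and lies in \<open>K = L \<inter> S\<close>, where \<open>L\<close> is the preimage of
  \<open>O\<^sub>p(G/C\<^sub>G(B))\<close>. The Frattini argument gives \<open>G = C\<^sub>G(B) N\<^sub>G(K)\<close>, so by invariance the intersection
  of \<open>B\<close> with the members of \<open>\<A>\<close> inside \<open>K\<close> is normal in \<open>G\<close>. It contains \<open>I \<inter> B\<close>, hence \<open>B\<close>, and
  is contained in \<open>A\<close>, a contradiction.

  For the last claim, an automorphism of \<open>G\<close> maps \<open>S\<close> to a conjugate of \<open>S\<close>, so after composition
  with an inner automorphism it restricts to an automorphism of \<open>S\<close>.\<close>

section \<open>Sylow subgroups and the Frattini argument\<close>

text \<open>Orbit lengths divide \<open>p ^ n\<close>. If no orbit were a single point,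
  \<open>p\<close> would divide each length, and hence their sum \<open>card E\<close>.\<close>

lemma (in group_action) fixed_point_exists:
  assumes p: "Factorial_Ring.prime p" and ord: "order G = p ^ n"
    and fin: "finite E" and ndvd: "\<not> p dvd card E"
  shows "\<exists>x\<in>E. \<forall>g\<in>carrier G. \<phi> g x = x"
proof (rule ccontr)
  assume no: "\<not> ?thesis"
  have "p dvd card (orbit G \<phi> x)" if x: "x \<in> E" for x
  proof -
    have "card (orbit G \<phi> x) dvd p ^ n"
      using orbit_stabilizer_theorem[OF x] ord by (metis dvd_triv_left)
    then obtain i where i: "card (orbit G \<phi> x) = p ^ i"
      using p divides_primepow_nat by blast
    have "i \<noteq> 0"
    proof
      assume "i = 0"
      then obtain y where "orbit G \<phi> x = {y}"
        using i by (auto simp: card_1_singleton_iff)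
      hence "\<phi> g x = x" if "g \<in> carrier G" for g
        using orbit_refl[OF x] that by (auto simp: orbit_def)
      thus False using no x by blast
    qed
    thus ?thesis using i by (cases i) auto
  qed
  hence "p dvd (\<Sum>orb\<in>orbits G E \<phi>. card orb)"
    by (intro dvd_sum) (auto simp: orbits_def)
  also have "(\<Sum>orb\<in>orbits G E \<phi>. card orb) = card E"
    using disjoint_sum[OF fin, of "\<lambda>_. 1::nat"] by simp
  finally show False using ndvd by simp
qed

context group
begin

lemma inv_l_cancel [simp]:
  "x \<in> carrier G \<Longrightarrow> y \<in> carrier G \<Longrightarrow> inv x \<otimes> (x \<otimes> y) = y"
  by (simp flip: m_assoc)

lemma inv_r_cancel [simp]:
  "x \<in> carrier G \<Longrightarrow> y \<in> carrier G \<Longrightarrow> x \<otimes> (inv x \<otimes> y) = y"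
  by (simp flip: m_assoc)

text \<open>\<open>f (inv g)\<close> inverts \<open>f g\<close> on \<open>E\<close>. The restriction
  makes the maps extensional, as \<open>BijGroup\<close> demands.\<close>

lemma group_action_restrictI:
  assumes cl: "\<And>g x. g \<in> carrier G \<Longrightarrow> x \<in> E \<Longrightarrow> f g x \<in> E"
    and one: "\<And>x. x \<in> E \<Longrightarrow> f \<one> x = x"
    and mult: "\<And>g h x. g \<in> carrier G \<Longrightarrow> h \<in> carrier G \<Longrightarrow> x \<in> E \<Longrightarrow> f (g \<otimes> h) x = f g (f h x)"
  shows "group_action G E (\<lambda>g. \<lambda>x\<in>E. f g x)"
proof -
  have "bij_betw (f g) E E" if g: "g \<in> carrier G" for g
    by (rule bij_betw_byWitness[where f' = "f (inv g)"])
      (use g one cl mult[of "inv g" g, symmetric] mult[of g "inv g", symmetric] in auto)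
  hence Bij: "(\<lambda>x\<in>E. f g x) \<in> Bij E" if "g \<in> carrier G" for g
    using that by (simp add: Bij_def bij_betw_restrict_eq)
  have "(\<lambda>g. \<lambda>x\<in>E. f g x) \<in> hom G (BijGroup E)"
    by (rule homI) (use Bij cl mult in \<open>auto simp: BijGroup_def compose_def fun_eq_iff\<close>)
  thus ?thesis
    by (simp add: group_action_def group_hom_def group_hom_axioms_def is_group group_BijGroup)
qed

text \<open>\<open>Q\<close> permutes \<open>E\<close> by right multiplication, and a fixed coset
  \<open>K #> g\<close> satisfies \<open>K g x = K g\<close>, that is, \<open>g x inv g\<close> lies
  in \<open>K\<close>. Allowing a part \<open>E\<close> of the cosets serves two uses: all cosets
  for Sylow conjugation, and all but one for subgroups of index \<open>p\<close>.\<close>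

lemma coset_fixed_point:
  assumes p: "Factorial_Ring.prime p" and Q: "subgroup Q G" "card Q = p ^ n"
    and K: "subgroup K G" and E: "E \<subseteq> rcosets K" "finite E" "\<not> p dvd card E"
    and stable: "\<And>X x. X \<in> E \<Longrightarrow> x \<in> Q \<Longrightarrow> X #> x \<in> E"
  shows "\<exists>g\<in>carrier G. K #> g \<in> E \<and> (\<forall>x\<in>Q. g \<otimes> x \<otimes> inv g \<in> K)"
proof -
  interpret Q: group "G\<lparr>carrier := Q\<rparr>" by (rule subgroup_imp_group[OF Q(1)])
  have Qc: "x \<in> carrier G" if "x \<in> Q" for x
    using subgroup.mem_carrier[OF Q(1) that] .
  have Ec: "X \<subseteq> carrier G" if "X \<in> E" for X
    using subsetD[OF rcosets_subset_PowG[OF K] subsetD[OF E(1) that]] by simp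
  \<comment> \<open>The inverse turns right multiplication into a left action.\<close>
  interpret group_action "G\<lparr>carrier := Q\<rparr>" E "\<lambda>x. \<lambda>X\<in>E. X #> inv x"
  proof (rule Q.group_action_restrictI)
    fix x X assume "x \<in> carrier (G\<lparr>carrier := Q\<rparr>)" "X \<in> E"
    thus "X #> inv x \<in> E" using stable subgroup.m_inv_closed[OF Q(1)] by simp
  next
    fix X assume "X \<in> E"
    thus "X #> inv \<one>\<^bsub>G\<lparr>carrier := Q\<rparr>\<^esub> = X" using Ec by simp
  next
    fix x y X assume xy: "x \<in> carrier (G\<lparr>carrier := Q\<rparr>)" "y \<in> carrier (G\<lparr>carrier := Q\<rparr>)"
      and "X \<in> E"
    thus "X #> inv (x \<otimes>\<^bsub>G\<lparr>carrier := Q\<rparr>\<^esub> y) = X #> inv y #> inv x"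
      using Ec Qc by (simp add: inv_mult_group coset_mult_assoc)
  qed
  obtain X where X: "X \<in> E" "\<And>x. x \<in> Q \<Longrightarrow> X #> inv x = X"
    using fixed_point_exists[OF p _ E(2,3), of n] Q(2) by (auto simp: order_def)
  obtain g where g: "g \<in> carrier G" "X = K #> g"
    using X(1) E(1) by (auto simp: RCOSETS_def)
  have "g \<otimes> x \<otimes> inv g \<in> K" if x: "x \<in> Q" for x
  proof -
    have "K #> (g \<otimes> x) = K #> g"
      using X(2)[of "inv x"] x g Qc subgroup.m_inv_closed[OF Q(1) x] subgroup.subset[OF K]
      by (simp add: coset_mult_assoc)
    hence "g \<otimes> x \<in> K #> g"
      using rcos_self[OF _ K, of "g \<otimes> x"] g Qc x by simp
    then obtain k where "k \<in> K" "g \<otimes> x = k \<otimes> g" by (auto simp: r_coset_def)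
    thus ?thesis
      using g(1) Qc[OF x] subgroup.mem_carrier[OF K] by (simp add: m_assoc)
  qed
  thus ?thesis using g X(1) by blast
qed

text \<open>Sylow's conjugacy theorem: \<open>Q\<close> acts on all \<open>m\<close> cosets of
  \<open>K\<close>, and \<open>p\<close> does not divide \<open>m\<close>.\<close>

lemma p_subgroup_conj_subset:
  assumes p: "Factorial_Ring.prime p" and fin: "finite (carrier G)"
    and Q: "subgroup Q G" "card Q = p ^ n"
    and K: "subgroup K G" "card K * m = order G" "\<not> p dvd m"
  shows "\<exists>g\<in>carrier G. \<forall>x\<in>Q. g \<otimes> x \<otimes> inv g \<in> K"
proof -
  have "card K > 0"
    using K(2) fin order_gt_0_iff_finite by (cases "card K") auto
  hence "card (rcosets K) = m"
    using lagrange[OF K(1)] K(2) by (metis mult.commute mult_cancel1 neq0_conv)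
  moreover have "X #> x \<in> rcosets K" if "X \<in> rcosets K" "x \<in> Q" for X x
    using that subgroup.subset[OF K(1)] subgroup.mem_carrier[OF Q(1)]
    by (auto simp: RCOSETS_def coset_mult_assoc)
  moreover have "finite (rcosets K)"
    using fin rcosets_subset_PowG[OF K(1)] finite_subset by blast
  ultimately show ?thesis
    using coset_fixed_point[OF p Q K(1) order_refl] K(3) by blast
qed

lemma conj_subset_imp_eq:
  assumes "finite H" "H \<subseteq> carrier G" "K \<subseteq> carrier G" "g \<in> carrier G"
    and "\<And>x. x \<in> H \<Longrightarrow> g \<otimes> x \<otimes> inv g \<in> K" and "card H = card K" "finite K"
  shows "g <# H #> inv g = K"
proof -
  have eq: "g <# H #> inv g = (\<lambda>x. g \<otimes> x \<otimes> inv g) ` H"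
    by (auto simp: l_coset_def r_coset_def)
  have "inj_on (\<lambda>x. g \<otimes> x \<otimes> inv g) H"
    using assms by (auto simp: inj_on_def subset_iff)
  hence "card (g <# H #> inv g) = card K"
    unfolding eq using assms by (simp add: card_image)
  moreover have "g <# H #> inv g \<subseteq> K" unfolding eq using assms by auto
  ultimately show ?thesis using assms by (simp add: card_subset_eq)
qed

lemma normalizer_iff:
  assumes "H \<subseteq> carrier G"
  shows "g \<in> normalizer G H \<longleftrightarrow> g \<in> carrier G \<and> g <# H #> inv g = H"
  using assms by (auto simp: normalizer_def stabilizer_def)

section \<open>Centralizers modulo a normal subgroup\<close>

text \<open>For normal \<open>N\<close> this is the preimage in \<open>G\<close> of the centralizer
  of the image of \<open>H\<close> in \<open>G/N\<close>, expressed without the quotient.\<close>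

definition commutes_mod :: "'a set \<Rightarrow> 'a set \<Rightarrow> 'a set" where
  "commutes_mod N H = {g \<in> carrier G. \<forall>h\<in>H. g \<otimes> h \<otimes> inv g \<otimes> inv h \<in> N}"

lemma subgroup_commutes_mod:
  assumes N: "N \<lhd> G" and H: "H \<subseteq> carrier G"
  shows "subgroup (commutes_mod N H) G"
proof
  interpret N: normal N G by fact
  fix a b assume ab: "a \<in> commutes_mod N H" "b \<in> commutes_mod N H"
  have abc: "a \<in> carrier G" "b \<in> carrier G"
    using ab by (auto simp: commutes_mod_def)
  show "a \<otimes> b \<in> commutes_mod N H"
    unfolding commutes_mod_def
  proof (safe)
    fix h assume h: "h \<in> H"
    \<comment> \<open>With [x,h] = x h inv x inv h, this is [ab,h] = a [b,h] inv a [a,h].\<close>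
    hence "a \<otimes> (b \<otimes> h \<otimes> inv b \<otimes> inv h) \<otimes> inv a \<otimes> (a \<otimes> h \<otimes> inv a \<otimes> inv h) \<in> N"
      using ab abc N.inv_op_closed2 by (auto simp: commutes_mod_def)
    thus "a \<otimes> b \<otimes> h \<otimes> inv (a \<otimes> b) \<otimes> inv h \<in> N"
      using h H abc by (simp add: m_assoc inv_mult_group subset_iff)
  qed (use abc in auto)
  show "inv a \<in> commutes_mod N H"
    unfolding commutes_mod_def
  proof (safe)
    fix h assume h: "h \<in> H"
    \<comment> \<open>The identity [inv a,h] = inv a (inv [a,h]) a.\<close>
    hence "inv a \<otimes> inv (a \<otimes> h \<otimes> inv a \<otimes> inv h) \<otimes> a \<in> N"
      using ab abc N.inv_op_closed1 by (auto simp: commutes_mod_def)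
    thus "inv a \<otimes> h \<otimes> inv (inv a) \<otimes> inv h \<in> N"
      using h H abc by (simp add: m_assoc inv_mult_group subset_iff)
  qed (use abc in auto)
qed (use H subgroup.one_closed[OF normal_imp_subgroup[OF N]] in \<open>auto simp: commutes_mod_def subset_iff\<close>)

lemma normal_commutes_mod:
  assumes N: "N \<lhd> G" and H: "H \<lhd> G"
  shows "commutes_mod N H \<lhd> G"
proof (rule normal_invI)
  interpret N: normal N G by fact
  interpret H: normal H G by fact
  show "subgroup (commutes_mod N H) G" using subgroup_commutes_mod[OF N H.subset] .
  fix x g assume x: "x \<in> carrier G" and g: "g \<in> commutes_mod N H"
  show "x \<otimes> g \<otimes> inv x \<in> commutes_mod N H"
    unfolding commutes_mod_def
  proof (safe)
    fix h assume h: "h \<in> H"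
    have "inv x \<otimes> h \<otimes> x \<in> H" using x h H.inv_op_closed1 by blast
    \<comment> \<open>The commutator of the conjugate of \<open>g\<close> with \<open>h\<close> is
      the conjugate by \<open>x\<close> of the commutator of \<open>g\<close> with
      \<open>inv x \<otimes> h \<otimes> x\<close>.\<close>
    hence "x \<otimes> (g \<otimes> (inv x \<otimes> h \<otimes> x) \<otimes> inv g \<otimes> inv (inv x \<otimes> h \<otimes> x)) \<otimes> inv x \<in> N"
      using g x N.inv_op_closed2 by (auto simp: commutes_mod_def)
    thus "x \<otimes> g \<otimes> inv x \<otimes> h \<otimes> inv (x \<otimes> g \<otimes> inv x) \<otimes> inv h \<in> N"
      using h x g by (simp add: m_assoc inv_mult_group commutes_mod_def)
  qed (use x g in \<open>auto simp: commutes_mod_def\<close>)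
qed

lemma centralizer_eq_commutes_mod:
  assumes "H \<subseteq> carrier G"
  shows "centralizer G H = commutes_mod {\<one>} H"
proof -
  have "g \<otimes> h = h \<otimes> g \<longleftrightarrow> g \<otimes> h \<otimes> inv g \<otimes> inv h = \<one>"
    if "g \<in> carrier G" "h \<in> carrier G" for g h
    using that by (metis inv_closed inv_inv inv_mult_group inv_solve_right m_assoc m_closed r_inv)
  thus ?thesis using assms by (auto simp: centralizer_def commutes_mod_def)
qed

lemma normal_centralizer:
  assumes "H \<lhd> G"
  shows "centralizer G H \<lhd> G"
  using normal_commutes_mod[OF one_is_normal assms]
  by (simp add: centralizer_eq_commutes_mod subgroup.subset normal_imp_subgroup assms)

lemma lagrange_subgroup:
  assumes "subgroup H G" "subgroup K G" "H \<subseteq> K"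
  shows "card H dvd card K"
  using group.lagrange[OF subgroup_imp_group[OF assms(2)], of H] subgroup_incl[OF assms]
  by (simp add: order_def) (metis dvd_triv_right)

section \<open>Maximal and derived subgroups of p-groups\<close>

lemma prime_index_maximal:
  assumes p: "Factorial_Ring.prime p" and fin: "finite (carrier G)"
    and M: "subgroup M G" "order G = p * card M"
    and N: "subgroup N G" "M \<subseteq> N" "\<not> N \<subseteq> M"
  shows "N = carrier G"
proof -
  have Nc: "N \<subseteq> carrier G" using subgroup.subset[OF N(1)] .
  have finN: "finite N" using Nc fin finite_subset by blast
  obtain r where r: "card N = card M * r" using lagrange_subgroup[OF M(1) N(1,2)] by blast
  obtain s where s: "order G = card N * s" using lagrange[OF N(1)] by (metis mult.commute)
  have "card M > 0" using M(2) fin order_gt_0_iff_finite by (cases "card M") auto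
  \<comment> \<open>Here \<open>r\<close> is the index of \<open>M\<close> in \<open>N\<close> and
    \<open>s\<close> that of \<open>N\<close> in \<open>G\<close>.\<close>
  hence "p = r * s" using M(2) r s by simp
  moreover have "r \<noteq> 1" using card_subset_eq[OF finN N(2)] r N(3) by auto
  ultimately have "s = 1" using p prime_product by blast
  thus ?thesis using s Nc fin by (simp add: order_def card_subset_eq)
qed

text \<open>The \<open>p - 1\<close> cosets other than \<open>M\<close> are permuted by \<open>M\<close>, so one of them is fixed and its
  representatives normalize \<open>M\<close>.\<close>

lemma index_p_normal:
  assumes p: "Factorial_Ring.prime p" and ord: "order G = p ^ Suc n"
    and M: "subgroup M G" "card M = p ^ n"
  shows "M \<lhd> G"
proof -
  have fin: "finite (carrier G)"
    using ord p order_gt_0_iff_finite by (simp add: prime_gt_0_nat)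
  have p1: "p > 1" using p prime_gt_1_nat by blast
  let ?E = "rcosets M - {M}"
  have MM: "M \<in> rcosets M" using subgroup.subgroup_in_rcosets[OF M(1)] is_group by blast
  have idx: "card (rcosets M) = p" using lagrange[OF M(1)] ord M(2) p1 by simp
  have finE: "finite (rcosets M)" using idx p1 card.infinite by fastforce
  hence cardE: "card ?E = p - 1" using MM idx by simp
  hence ndvd: "\<not> p dvd card ?E" using p1 by (auto dest: dvd_imp_le)
  have Mc: "M \<subseteq> carrier G" using subgroup.subset[OF M(1)] .
  have stable: "X #> x \<in> ?E" if X: "X \<in> ?E" and x: "x \<in> M" for X x
  proof -
    obtain g where g: "g \<in> carrier G" "X = M #> g" using X by (auto simp: RCOSETS_def)
    have xc: "x \<in> carrier G" using x Mc by blast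
    have "X #> x \<in> rcosets M"
      using g xc Mc by (auto simp: RCOSETS_def coset_mult_assoc)
    moreover have "X #> x \<noteq> M"
    proof
      assume "X #> x = M"
      hence "M #> inv x = X"
        using g xc Mc by (metis coset_mult_inv2 r_coset_subset_G coset_mult_assoc inv_closed)
      moreover have "M #> inv x = M"
        using coset_join2[OF _ M(1)] xc subgroup.m_inv_closed[OF M(1) x] by simp
      ultimately show False using X by simp
    qed
    ultimately show ?thesis by simp
  qed
  obtain g where g: "g \<in> carrier G" "M #> g \<in> ?E" and gM: "\<And>x. x \<in> M \<Longrightarrow> g \<otimes> x \<otimes> inv g \<in> M"
    using coset_fixed_point[OF p M M(1) _ _ ndvd stable] finE by blast
  have gnM: "g \<notin> M" using g coset_join2[OF _ M(1)] by auto
  let ?N = "normalizer G M"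
  have finM: "finite M" using fin Mc finite_subset by blast
  have N: "subgroup ?N G" using normalizer_imp_subgroup[OF Mc] .
  have Neq: "x \<in> ?N" if "x \<in> carrier G" "\<And>y. y \<in> M \<Longrightarrow> x \<otimes> y \<otimes> inv x \<in> M" for x
    using that conj_subset_imp_eq[OF finM Mc Mc] finM normalizer_iff[OF Mc] by auto
  have MN: "M \<subseteq> ?N"
  proof
    fix x assume x: "x \<in> M"
    show "x \<in> ?N"
      by (rule Neq)
        (use x Mc subgroup.m_closed[OF M(1)] subgroup.m_inv_closed[OF M(1)] in auto)
  qed
  \<comment> \<open>\<open>g\<close> normalizes \<open>M\<close> and lies outside it, so the
    normalizer is strictly larger than \<open>M\<close>.\<close>
  have "?N = carrier G"
    proof (rule prime_index_maximal[OF p fin M(1) _ N MN])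
    show "\<not> ?N \<subseteq> M" using Neq[OF g(1) gM] gnM by blast
  qed (simp add: ord M(2))
  hence conj: "x <# M #> inv x = M" if "x \<in> carrier G" for x
    using that normalizer_iff[OF Mc] by blast
  show ?thesis
  proof (rule normal_invI[OF M(1)])
    fix x h assume "x \<in> carrier G" "h \<in> M"
    thus "x \<otimes> h \<otimes> inv x \<in> M" using conj[of x] by (auto simp: l_coset_def r_coset_def)
  qed
qed

text \<open>A subgroup \<open>M\<close> of index \<open>p\<close> is normal with quotient of prime
  order, hence abelian, so \<open>M\<close> contains the derived subgroup.\<close>

lemma derived_proper:
  assumes p: "Factorial_Ring.prime p" and ord: "order G = p ^ Suc n"
  shows "derived G (carrier G) \<noteq> carrier G"
proof -
  have p1: "p > 1" using p prime_gt_1_nat by blast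
  have fin: "finite (carrier G)"
    using ord p1 order_gt_0_iff_finite by simp
  \<comment> \<open>\<open>sylow_thm\<close> allows a cofactor divisible by \<open>p\<close>, so it
    yields a subgroup of order exactly \<open>p ^ n\<close>.\<close>
  have ord': "order G = p ^ n * p" using ord by simp
  obtain M where M: "subgroup M G" "card M = p ^ n"
    using sylow_thm[OF p is_group ord' fin] by blast
  interpret M: normal M G by (rule index_p_normal[OF p ord M])
  have "M \<noteq> carrier G"
  proof
    assume "M = carrier G"
    thus False using ord M(2) p1 by (simp add: order_def)
  qed
  then obtain x where x: "x \<in> carrier G" "x \<notin> M" using M.subset by blast
  \<comment> \<open>This subgroup contains the normal subgroup \<open>M\<close>; having prime index,
    \<open>M\<close> leaves no room once \<open>x\<close> outside \<open>M\<close> belongs to it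
    too.\<close>
  have full: "commutes_mod M {g} = carrier G"
    if g: "g \<in> carrier G" and xg: "x \<in> commutes_mod M {g}" for g
  proof (rule prime_index_maximal[OF p fin M(1)])
    show "subgroup (commutes_mod M {g}) G"
      using subgroup_commutes_mod[OF M.normal_axioms] g by simp
    show "M \<subseteq> commutes_mod M {g}"
    proof
      fix m assume m: "m \<in> M"
      have "m \<otimes> (g \<otimes> inv m \<otimes> inv g) \<in> M"
        using m M.inv_op_closed2[OF g, of "inv m"] by blast
      thus "m \<in> commutes_mod M {g}"
        using m g by (simp add: commutes_mod_def m_assoc)
    qed
  qed (use ord M(2) x xg in auto)
  \<comment> \<open>\<open>full\<close> is used twice: \<open>x\<close> commutes with itself, so
    everything commutes with \<open>x\<close> modulo \<open>M\<close>; then \<open>x\<close> lies in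
    \<open>commutes_mod M {g}\<close> for each \<open>g\<close>, which makes that subgroup full as
    well.\<close>
  have "x \<in> commutes_mod M {x}"
    using x by (simp add: commutes_mod_def m_assoc)
  hence xfull: "commutes_mod M {x} = carrier G" using full x by blast
  have "derived_set G (carrier G) \<subseteq> M"
  proof clarify
    fix h g assume hg: "h \<in> carrier G" "g \<in> carrier G"
    have "inv (g \<otimes> x \<otimes> inv g \<otimes> inv x) \<in> M"
      using xfull hg by (auto simp: commutes_mod_def)
    hence "x \<in> commutes_mod M {g}"
      using hg x by (simp add: commutes_mod_def m_assoc inv_mult_group)
    thus "h \<otimes> g \<otimes> inv h \<otimes> inv g \<in> M"
      using full[of g] hg by (auto simp: commutes_mod_def)
  qed
  hence "derived G (carrier G) \<subseteq> M"
    unfolding derived_def by (rule generate_subgroup_incl[OF _ M(1)])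
  thus ?thesis using x by blast
qed

section \<open>Sylow subgroups of normal subgroups\<close>

text \<open>By the second isomorphism theorem, the index of \<open>L \<inter> S\<close> in
  \<open>L\<close> equals that of \<open>S\<close> in \<open>LS\<close>, which divides the index
  \<open>m\<close> of \<open>S\<close> in \<open>G\<close>.\<close>

lemma index_Int_normal:
  assumes L: "L \<lhd> G" and S: "subgroup S G" "card S * m = order G" and fin: "finite (carrier G)"
  shows "\<exists>m'. card (L \<inter> S) * m' = card L \<and> m' dvd m"
proof -
  interpret L: normal L G by fact
  interpret second_isomorphism_grp L G S
    by (simp add: second_isomorphism_grp_def second_isomorphism_grp_axioms_def L S)
  let ?LS = "L <#> S"
  have gLS: "group (G\<lparr>carrier := ?LS\<rparr>)" and gS: "group (G\<lparr>carrier := S\<rparr>)"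
    using subgroup_imp_group normal_set_mult_subgroup S(1) by auto
  define r where "r = order (G\<lparr>carrier := S\<rparr> Mod (L \<inter> S))"
  have r': "r = order (G\<lparr>carrier := ?LS\<rparr> Mod L)"
    using normal_intersection_quotient_isom unfolding iso_def order_def r_def
    by (auto dest: bij_betw_same_card)
  have "L \<lhd> G\<lparr>carrier := ?LS\<rparr>"
    by (simp add: H_contained_in_set_mult normal_restrict_supergroup normal_set_mult_subgroup L)
  hence 1: "r * card L = card ?LS"
    using group.lagrange[OF gLS, of L] by (simp add: r' normal_def order_def FactGroup_def)
  have "L \<inter> S \<lhd> G\<lparr>carrier := S\<rparr>" using normal_Int_subgroup[OF S(1) L] .
  hence 2: "r * card (L \<inter> S) = card S"
    using group.lagrange[OF gS, of "L \<inter> S"] by (simp add: r_def normal_def order_def FactGroup_def)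
  obtain t where t: "order G = card ?LS * t"
    using lagrange[OF normal_set_mult_subgroup] by (metis mult.commute)
  obtain m' where m': "card L = card (L \<inter> S) * m'"
    using lagrange_subgroup[OF subgroups_Inter_pair[OF L.subgroup_axioms S(1)] L.subgroup_axioms]
    by blast
  have ord0: "order G > 0" using fin order_gt_0_iff_finite by simp
  have "card S * m = card S * (m' * t)"
    using 1 2 t S(2) m' by (metis mult.assoc)
  moreover have "card S > 0" using ord0 S(2) by (cases "card S") auto
  ultimately have "m = m' * t" by simp
  thus ?thesis using m' by auto
qed

lemma normal_p_subgroupD:
  assumes "normal_p_subgroup p N G"
  shows "N \<lhd> G" "\<exists>n. card N = p ^ n"
  using assms by (auto simp: normal_p_subgroup_def p_group_def order_def)

lemma normal_p_subgroupI:
  assumes "N \<lhd> G" "card N = p ^ n"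
  shows "normal_p_subgroup p N G"
  using assms subgroup_imp_group[OF normal_imp_subgroup]
  by (auto simp: normal_p_subgroup_def p_group_def order_def)

text \<open>The index of \<open>N \<inter> S\<close> in \<open>N\<close> is a power of
  \<open>p\<close> that divides \<open>m\<close>, hence is 1.\<close>

lemma normal_p_subgroup_subset_sylow:
  assumes p: "Factorial_Ring.prime p" and fin: "finite (carrier G)"
    and S: "subgroup S G" "card S * m = order G" "\<not> p dvd m" and N: "normal_p_subgroup p N G"
  shows "N \<subseteq> S"
proof -
  obtain m' where m': "card (N \<inter> S) * m' = card N" "m' dvd m"
    using index_Int_normal[OF normal_p_subgroupD(1)[OF N] S(1,2) fin] by blast
  obtain n where "card N = p ^ n" using normal_p_subgroupD(2)[OF N] by blast
  hence "m' dvd p ^ n" using m' by (metis dvd_triv_right)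
  then obtain i where "m' = p ^ i" using p divides_primepow_nat by blast
  hence "m' = 1" using m'(2) S(3) by (cases i) (auto dest: dvd_mult_left)
  moreover have "finite N"
    using fin subgroup.subset[OF normal_imp_subgroup[OF normal_p_subgroupD(1)[OF N]]] finite_subset
    by blast
  ultimately show ?thesis
    using m'(1) card_subset_eq[of N "N \<inter> S"] by auto
qed

text \<open>\<open>K\<close> is a Sylow subgroup of \<open>L\<close>, and \<open>L/C\<close> is a
  p-group, so \<open>L = CK\<close>. The Frattini argument gives \<open>G\<close> as the product of
  \<open>L\<close> and the normalizer of \<open>K\<close>; the latter absorbs the factor
  \<open>K\<close> of \<open>L\<close>.\<close>

lemma frattini_factorization:
  assumes p: "Factorial_Ring.prime p" and fin: "finite (carrier G)"
    and L: "L \<lhd> G" and C: "C \<lhd> G" "C \<subseteq> L" "card L = card C * p ^ k"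
    and K: "subgroup K G" "K \<subseteq> L" "card K = p ^ a" "card K * m = card L" "\<not> p dvd m"
    and g: "g \<in> carrier G"
  shows "\<exists>c\<in>C. \<exists>n\<in>normalizer G K. g = c \<otimes> n"
proof -
  interpret L: normal L G by fact
  interpret C: normal C G by fact
  interpret second_isomorphism_grp C G K
    by (simp add: second_isomorphism_grp_def second_isomorphism_grp_axioms_def C K)
  interpret GL: group "G\<lparr>carrier := L\<rparr>" by (rule subgroup_imp_group[OF L.subgroup_axioms])
  have finL: "finite L" using fin L.subset finite_subset by blast
  have Kc: "K \<subseteq> carrier G" using subgroup.subset[OF K(1)] .
  \<comment> \<open>The index \<open>i\<close> of \<open>CK\<close> in \<open>L\<close> divides both
    \<open>p ^ k\<close> and \<open>m\<close>.\<close>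
  have LCK: "L = C <#> K"
  proof -
    have sub: "C <#> K \<subseteq> L"
      using C(2) K(2) L.m_closed by (auto simp: set_mult_def)
    obtain i where i: "card L = card (C <#> K) * i"
      using lagrange_subgroup[OF normal_set_mult_subgroup L.subgroup_axioms sub] by blast
    obtain r where r: "card (C <#> K) = card C * r"
      using lagrange_subgroup[OF C.subgroup_axioms normal_set_mult_subgroup
          H_contained_in_set_mult] by blast
    obtain s where s: "card (C <#> K) = card K * s"
      using lagrange_subgroup[OF K(1) normal_set_mult_subgroup S_contained_in_set_mult] by blast
    have "card L > 0" using finL L.one_closed card_gt_0_iff by blast
    hence pos: "card C > 0" "card K > 0" using C(3) K(4) by (auto intro: gr0I)
    have "r * i = p ^ k" using i r C(3) pos by simp
    then obtain j where j: "i = p ^ j" using p divides_primepow_nat by (metis dvd_triv_right)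
    have "s * i = m" using i s K(4) pos by (metis mult.assoc mult_cancel1 neq0_conv)
    hence "i dvd m" by auto
    hence "i = 1" using j K(5) by (cases j) (auto dest: dvd_mult_left)
    thus ?thesis using i card_subset_eq[OF finL sub] by simp
  qed
  let ?Q = "(\<lambda>x. g \<otimes> x \<otimes> inv g) ` K"
  have "(\<lambda>x. g \<otimes> x \<otimes> inv g) \<in> hom G G"
    using g by (auto intro!: homI simp: m_assoc)
  hence "group_hom G G (\<lambda>x. g \<otimes> x \<otimes> inv g)"
    by (simp add: group_hom_def group_hom_axioms_def is_group)
  from group_hom.subgroup_img_is_subgroup[OF this K(1)] have "subgroup ?Q G" .
  moreover have QL: "?Q \<subseteq> L" using K(2) L.inv_op_closed2 g by blast
  ultimately have Q: "subgroup ?Q (G\<lparr>carrier := L\<rparr>)"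
    using subgroup_incl L.subgroup_axioms by blast
  have cQ: "card ?Q = p ^ a"
    using g Kc K(3) by (subst card_image) (auto simp: inj_on_def subset_iff)
  \<comment> \<open>The conjugate \<open>?Q\<close> of \<open>K\<close> by \<open>g\<close> is again
    a p-subgroup of \<open>L\<close>, so Sylow's theorem inside \<open>L\<close> moves it back into
    \<open>K\<close>.\<close>
  obtain l where l: "l \<in> L" and lQ: "\<And>x. x \<in> ?Q \<Longrightarrow> l \<otimes> x \<otimes> inv l \<in> K"
    using GL.p_subgroup_conj_subset[OF p _ Q cQ, of K m] finL K(4,5)
      subgroup_incl[OF K(1) L.subgroup_axioms K(2)]
    by (auto simp: order_def m_inv_consistent[OF L.subgroup_axioms])
  have lc: "l \<in> carrier G" using l by simp
  obtain c b where cb: "c \<in> C" "b \<in> K" "inv l = c \<otimes> b"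
    using l LCK L.m_inv_closed[OF l] by (auto simp: set_mult_def)
  have bc: "b \<in> carrier G" "c \<in> carrier G" using cb Kc by auto
  \<comment> \<open>\<open>l \<otimes> g\<close> normalizes \<open>K\<close> and \<open>b\<close>
    lies in \<open>K\<close>; moreover \<open>c \<otimes> b\<close> cancels \<open>l\<close>,
    leaving \<open>g\<close>.\<close>
  let ?n = "b \<otimes> (l \<otimes> g)"
  have "?n \<otimes> x \<otimes> inv ?n \<in> K" if x: "x \<in> K" for x
  proof -
    have "b \<otimes> (l \<otimes> (g \<otimes> x \<otimes> inv g) \<otimes> inv l) \<otimes> inv b \<in> K"
      using lQ x cb(2) subgroup.m_closed[OF K(1)] subgroup.m_inv_closed[OF K(1)] by auto
    thus ?thesis
      using x g bc Kc lc by (simp add: m_assoc inv_mult_group subset_iff)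
  qed
  hence "?n \<in> normalizer G K"
    using conj_subset_imp_eq[OF _ Kc Kc, of ?n] normalizer_iff[OF Kc] bc lc g
      finite_subset[OF Kc fin] by auto
  moreover have "g = c \<otimes> ?n"
  proof -
    have "c \<otimes> ?n = inv l \<otimes> (l \<otimes> g)" using cb bc lc g by (simp add: m_assoc)
    thus ?thesis using lc g by simp
  qed
  ultimately show ?thesis using cb(1) by blast
qed

section \<open>Conjugation actions on normal subgroups\<close>

lemma action_centralizer_conj:
  assumes "P \<lhd> G"
  shows "action_centralizer G (G\<lparr>carrier := P\<rparr>) (conj_action G P) = centralizer G P"
proof -
  interpret normal P G by fact
  have "g \<otimes> w \<otimes> inv g = w \<longleftrightarrow> g \<otimes> w = w \<otimes> g" if "g \<in> carrier G" "w \<in> P" for g w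
    using that inv_solve_right[of w "g \<otimes> w" g] by auto
  thus ?thesis by (auto simp: action_centralizer_def centralizer_def conj_action_def)
qed

text \<open>\<open>L\<close> is the union of the cosets of \<open>C\<close> that make up
  \<open>O_p(G/C)\<close>, so the correspondence theorem gives its normality and its order.\<close>

lemma action_p_core_conj:
  assumes p: "Factorial_Ring.prime p" and fin: "finite (carrier G)" and P: "P \<lhd> G"
  defines "C \<equiv> centralizer G P"
    and "L \<equiv> action_p_core p G (G\<lparr>carrier := P\<rparr>) (conj_action G P)"
  shows "L \<lhd> G" "C \<subseteq> L" "\<exists>k. card L = card C * p ^ k"
proof -
  interpret C: normal C G unfolding C_def by (rule normal_centralizer[OF P])
  let ?A = "p_core p (G Mod C)"
  have "finite (carrier (G Mod C))"
    using fin by (simp add: carrier_FactGroup)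
  hence A: "normal_p_subgroup p ?A (G Mod C)"
    using p_core_greatest(1)[OF p C.factorgroup_is_group] by blast
  hence An: "?A \<lhd> G Mod C" by (simp add: normal_p_subgroup_def)
  have As: "subgroup ?A (G Mod C)" using normal_imp_subgroup[OF An] .
  have L: "L = \<Union>?A"
    unfolding C.factgroup_subgroup_union_char[OF As] L_def action_p_core_def
    by (simp add: action_centralizer_conj[OF P] C_def)
  show LG: "L \<lhd> G" unfolding L by (rule C.factgroup_subgroup_union_normal[OF An])
  have sL: "subgroup L G" using normal_imp_subgroup[OF LG] .
  have "C \<in> ?A" using subgroup.one_closed[OF As] by simp
  thus CL: "C \<subseteq> L" unfolding L by blast
  obtain k where "card ?A = p ^ k"
    using A by (auto simp: normal_p_subgroup_def p_group_def order_def)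
  moreover have "card ?A * card C = card L"
    using group.lagrange[OF subgroup_imp_group[OF sL], of C] subgroup_incl[OF C.subgroup_axioms sL CL]
      C.factgroup_subgroup_union_factor[OF As, symmetric]
    by (simp add: order_def flip: L)
  ultimately show "\<exists>k. card L = card C * p ^ k" by (metis mult.commute)
qed

text \<open>[w,x] is the inverse of \<open>inv w \<otimes> x \<otimes> w\<close> times
  \<open>x\<close>, so [P,x] lies in \<open>H \<inter> P\<close>, which \<open>x\<close>
  centralizes. It is applied with \<open>H\<close> an abelian subgroup normalized by
  \<open>P\<close>.\<close>

lemma acts_quadraticallyI:
  assumes P: "P \<lhd> G" and H: "subgroup H G" and x: "x \<in> H"
    and comm: "\<And>h. h \<in> H \<Longrightarrow> x \<otimes> h = h \<otimes> x"
    and norm: "\<And>w. w \<in> P \<Longrightarrow> inv w \<otimes> x \<otimes> w \<in> H"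
  shows "acts_quadratically G (G\<lparr>carrier := P\<rparr>) (conj_action G P) x"
proof -
  interpret P: normal P G by fact
  interpret H: subgroup H G by fact
  interpret GP: group "G\<lparr>carrier := P\<rparr>" by (rule subgroup_imp_group[OF P.subgroup_axioms])
  have xc: "x \<in> carrier G" using x by simp
  have ac: "action_commutator G (G\<lparr>carrier := P\<rparr>) (conj_action G P) w x
      = inv w \<otimes> inv x \<otimes> w \<otimes> x" if "w \<in> P" for w
    using that xc by (simp add: action_commutator_def conj_action_def m_assoc
        m_inv_consistent[OF P.subgroup_axioms])
  have HP: "subgroup (H \<inter> P) (G\<lparr>carrier := P\<rparr>)"
    using subgroup_incl[OF subgroups_Inter_pair[OF H P.subgroup_axioms] P.subgroup_axioms] by simp
  let ?K = "action_commutator_subgroup G (G\<lparr>carrier := P\<rparr>) (conj_action G P) P x"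
  have comms: "inv w \<otimes> inv x \<otimes> w \<otimes> x \<in> H \<inter> P" if w: "w \<in> P" for w
  proof
    have "inv (inv w \<otimes> x \<otimes> w) \<in> H" using norm[OF w] by blast
    hence "inv w \<otimes> inv x \<otimes> w \<in> H" using w xc by (simp add: inv_mult_group m_assoc)
    thus "inv w \<otimes> inv x \<otimes> w \<otimes> x \<in> H" using x by blast
    have "inv w \<otimes> (inv x \<otimes> w \<otimes> x) \<in> P" using w P.inv_op_closed1[OF xc w] by blast
    thus "inv w \<otimes> inv x \<otimes> w \<otimes> x \<in> P" using w xc by (simp add: m_assoc)
  qed
  have K: "action_commutator_subgroup G (G\<lparr>carrier := P\<rparr>) (conj_action G P)
      (carrier (G\<lparr>carrier := P\<rparr>)) x \<subseteq> H \<inter> P"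
    unfolding action_commutator_subgroup_def
  proof (rule GP.generate_subgroup_incl[OF _ HP], clarify)
    fix w assume "w \<in> carrier (G\<lparr>carrier := P\<rparr>)"
    hence "w \<in> P" by simp
    thus "action_commutator G (G\<lparr>carrier := P\<rparr>) (conj_action G P) w x \<in> H \<inter> P"
      using comms ac by simp
  qed
  define K where "K = action_commutator_subgroup G (G\<lparr>carrier := P\<rparr>) (conj_action G P)
      (carrier (G\<lparr>carrier := P\<rparr>)) x"
  have "action_commutator_subgroup G (G\<lparr>carrier := P\<rparr>) (conj_action G P) K x \<subseteq> {\<one>}"
    unfolding action_commutator_subgroup_def
  proof (rule GP.generate_subgroup_incl, clarify)
    fix w assume "w \<in> K"
    hence w: "w \<in> H" "w \<in> P" using K by (auto simp: K_def)
    hence "inv w \<otimes> inv x \<otimes> w \<otimes> x = \<one>" using comm[of w, symmetric] xc by (simp add: m_assoc)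
    thus "action_commutator G (G\<lparr>carrier := P\<rparr>) (conj_action G P) w x = \<one>" using ac w(2) by simp
  qed (use GP.triv_subgroup in simp)
  moreover have "\<one> \<in> action_commutator_subgroup G (G\<lparr>carrier := P\<rparr>) (conj_action G P) K x"
    using generate.one[of "G\<lparr>carrier := P\<rparr>"]
    by (simp add: action_commutator_subgroup_def)
  ultimately show ?thesis unfolding acts_quadratically_def K_def by simp blast
qed

section \<open>Nilpotency class at most 2\<close>

lemma nilpotency_class_le_2I:
  assumes B: "subgroup B G" and cen: "B \<subseteq> centralizer G (derived G B)"
  shows "nilpotency_class_le (G\<lparr>carrier := B\<rparr>) 2"
proof -
  interpret B: subgroup B G by fact
  interpret GB: group "G\<lparr>carrier := B\<rparr>" by (rule subgroup_imp_group[OF B])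
  have D: "subgroup (derived G B) (G\<lparr>carrier := B\<rparr>)"
    using subgroup_incl[OF derived_is_subgroup[OF B.subset] B derived_incl[OF order_refl B]] .
  have Dc: "d \<in> carrier G" if "d \<in> derived G B" for d
    using that derived_in_carrier[OF B.subset] by blast
  \<comment> \<open>\<open>derived\<close> is generated by the commutators
    \<open>h k inv h inv k\<close>; replacing both entries by their inverses gives the form used in
    \<open>commutator_subgroup\<close>.\<close>
  have in_D: "inv h \<otimes> inv k \<otimes> h \<otimes> k \<in> derived G B" if "h \<in> B" "k \<in> B" for h k
    unfolding derived_def
  proof (rule generate.incl, rule UN_I, rule_tac [2] UN_I)
    show "inv h \<in> B" "inv k \<in> B" using that by auto
  qed (use that in simp)
  have L: "commutator_subgroup (G\<lparr>carrier := B\<rparr>) B B \<subseteq> derived G B"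
    unfolding commutator_subgroup_def
  proof (rule GB.generate_subgroup_incl[OF _ D], clarify)
    fix h k assume "h \<in> B" "k \<in> B"
    thus "inv\<^bsub>G\<lparr>carrier := B\<rparr>\<^esub> h \<otimes>\<^bsub>G\<lparr>carrier := B\<rparr>\<^esub> inv\<^bsub>G\<lparr>carrier := B\<rparr>\<^esub> k
        \<otimes>\<^bsub>G\<lparr>carrier := B\<rparr>\<^esub> h \<otimes>\<^bsub>G\<lparr>carrier := B\<rparr>\<^esub> k \<in> derived G B"
      using in_D by (simp add: m_inv_consistent[OF B])
  qed
  have comms: "inv h \<otimes> inv k \<otimes> h \<otimes> k = \<one>" if hk: "h \<in> derived G B" "k \<in> B" for h k
  proof -
    have "k \<otimes> h = h \<otimes> k" using cen hk by (auto simp: centralizer_def)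
    thus ?thesis using Dc hk by (simp add: m_assoc flip: inv_mult_group)
  qed
  have DB: "h \<in> B" if "h \<in> derived G B" for h
    using that derived_incl[OF order_refl B] by blast
  \<comment> \<open>As \<open>lower_central\<close> starts at index 0, its value at 2 is
    [[B,B],B].\<close>
  have "commutator_subgroup (G\<lparr>carrier := B\<rparr>)
      (commutator_subgroup (G\<lparr>carrier := B\<rparr>) B B) B \<subseteq> {\<one>}"
    unfolding commutator_subgroup_def[of _ "commutator_subgroup _ _ _"]
  proof (rule GB.generate_subgroup_incl, clarify)
    fix h k assume h: "h \<in> commutator_subgroup (G\<lparr>carrier := B\<rparr>) B B" and k: "k \<in> B"
    have "h \<in> derived G B" using h L by blast
    thus "inv\<^bsub>G\<lparr>carrier := B\<rparr>\<^esub> h \<otimes>\<^bsub>G\<lparr>carrier := B\<rparr>\<^esub> inv\<^bsub>G\<lparr>carrier := B\<rparr>\<^esub> k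
        \<otimes>\<^bsub>G\<lparr>carrier := B\<rparr>\<^esub> h \<otimes>\<^bsub>G\<lparr>carrier := B\<rparr>\<^esub> k = \<one>"
      using comms DB k by (simp add: m_inv_consistent[OF B])
  qed (use GB.triv_subgroup in simp)
  moreover have "\<one> \<in> commutator_subgroup (G\<lparr>carrier := B\<rparr>)
      (commutator_subgroup (G\<lparr>carrier := B\<rparr>) B B) B"
    using generate.one[of "G\<lparr>carrier := B\<rparr>"] by (simp add: commutator_subgroup_def)
  ultimately show ?thesis
    by (simp add: nilpotency_class_le_def numeral_2_eq_2 subset_antisym)
qed

end

section \<open>Families with invariance and replacement\<close>

lemma (in group) fam_Inter_subgroup:
  assumes "\<And>A. A \<in> \<A> \<Longrightarrow> subgroup A G"
  shows "subgroup (fam_Inter G \<A>) G"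
  using assms subgroups_Inter[of \<A>] triv_subgroup by (simp add: fam_Inter_def)

lemma (in group) normalizer_conjD:
  assumes "H \<subseteq> carrier G" "g \<in> normalizer G H" "h \<in> H"
  shows "g \<otimes> h \<otimes> inv g \<in> H"
  using assms normalizer_iff[OF assms(1), of g] by (auto simp: l_coset_def r_coset_def)

lemma (in group) normal_restrict_conj:
  assumes S: "subgroup S G" and H: "H \<lhd> G\<lparr>carrier := S\<rparr>" and g: "g \<in> S" "h \<in> H"
  shows "g \<otimes> h \<otimes> inv g \<in> H"
  using normal.inv_op_closed2[OF H, of g h] g by (simp add: m_inv_consistent[OF S])

lemma (in group) normal_restrict_iff:
  assumes S: "subgroup S G"
  shows "H \<lhd> G\<lparr>carrier := S\<rparr> \<longleftrightarrow>
    subgroup H G \<and> H \<subseteq> S \<and> (\<forall>g\<in>S. \<forall>h\<in>H. g \<otimes> h \<otimes> inv g \<in> H)"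
proof
  assume H: "H \<lhd> G\<lparr>carrier := S\<rparr>"
  have "subgroup H (G\<lparr>carrier := S\<rparr>)" using normal_imp_subgroup[OF H] .
  thus "subgroup H G \<and> H \<subseteq> S \<and> (\<forall>g\<in>S. \<forall>h\<in>H. g \<otimes> h \<otimes> inv g \<in> H)"
    using incl_subgroup[OF S] subgroup.subset[of H "G\<lparr>carrier := S\<rparr>"]
      normal_restrict_conj[OF S H] by simp
next
  assume "subgroup H G \<and> H \<subseteq> S \<and> (\<forall>g\<in>S. \<forall>h\<in>H. g \<otimes> h \<otimes> inv g \<in> H)"
  thus "H \<lhd> G\<lparr>carrier := S\<rparr>"
    using group.normal_invI[OF subgroup_imp_group[OF S], of H] subgroup_incl[of H S] S
    by (simp add: m_inv_consistent[OF S])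
qed

lemma (in group) sylow_subgroup_index:
  assumes p: "Factorial_Ring.prime p" and fin: "finite (carrier G)" and S: "sylow_subgroup p S G"
  shows "\<exists>m. card S * m = order G \<and> \<not> p dvd m"
proof -
  have "order G \<noteq> 0" using fin order_gt_0_iff_finite by simp
  moreover have "\<not> is_unit p" using p not_prime_unit by blast
  ultimately obtain m where "order G = p ^ multiplicity p (order G) * m" "\<not> p dvd m"
    using multiplicity_decompose' by metis
  thus ?thesis using S unfolding sylow_subgroup_def by metis
qed

text \<open>Nonemptiness lets \<open>\<Inter>\<A>\<close> stand for \<open>fam_Inter G \<A>\<close>;
  for the empty family it would be the whole type.\<close>

locale invariant_replacement_family = group G for G (structure) +
  fixes p :: nat and S :: "'a set" and \<A> :: "'a set set"
  assumes p: "Factorial_Ring.prime p" and fin: "finite (carrier G)"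
    and sylow: "sylow_subgroup p S G"
    and centralizer_core: "centralizer G (p_core p G) \<subseteq> p_core p G"
    and p_stable: "\<And>P. normal_p_subgroup p P G \<Longrightarrow>
      p_stable_action p G (G\<lparr>carrier := P\<rparr>) (conj_action G P)"
    and abelian: "abelian_subgroups_of G S \<A>"
    and invariance: "invariance_property G S \<A>"
    and replacement: "replacement_property G S \<A>"
    and nonempty: "\<A> \<noteq> {}"
begin

abbreviation I :: "'a set" where "I \<equiv> \<Inter>\<A>"

lemma subgroup_S: "subgroup S G"
  using sylow by (simp add: sylow_subgroup_def)

lemma S_carrier: "S \<subseteq> carrier G"
  using subgroup.subset[OF subgroup_S] .

lemma finite_S: "finite S"
  using finite_subset[OF S_carrier fin] .

lemma sylow_index: "\<exists>m. card S * m = order G \<and> \<not> p dvd m"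
  using sylow_subgroup_index[OF p fin sylow] .

lemma member:
  assumes "A \<in> \<A>"
  shows "subgroup A G" "A \<subseteq> S" "\<And>x y. x \<in> A \<Longrightarrow> y \<in> A \<Longrightarrow> x \<otimes> y = y \<otimes> x"
proof -
  have A: "subgroup A (G\<lparr>carrier := S\<rparr>)" "comm_group (G\<lparr>carrier := A\<rparr>)"
    using abelian assms by (auto simp: abelian_subgroups_of_def)
  show "subgroup A G" using incl_subgroup[OF subgroup_S A(1)] .
  show "A \<subseteq> S" using subgroup.subset[OF A(1)] by simp
  show "x \<otimes> y = y \<otimes> x" if "x \<in> A" "y \<in> A" for x y
    using comm_groupE(4)[OF A(2)] that by simp
qed

lemma I_subset_S: "I \<subseteq> S"
  using nonempty member(2) by blast

lemma subgroup_I: "subgroup I G"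
  using subgroups_Inter[of \<A>] member(1) nonempty by blast

lemma I_commute: "x \<in> I \<Longrightarrow> y \<in> I \<Longrightarrow> x \<otimes> y = y \<otimes> x"
  using nonempty member(3) by blast

lemma fam_Inter_restrict_conj:
  assumes P: "P \<lhd> G\<lparr>carrier := S\<rparr>" and g: "g \<in> normalizer G P"
    and h: "h \<in> fam_Inter G (fam_restrict \<A> P)"
  shows "g \<otimes> h \<otimes> inv g \<in> fam_Inter G (fam_restrict \<A> P)"
proof -
  have "g <# fam_Inter G (fam_restrict \<A> P) #> inv g = fam_Inter G (fam_restrict \<A> P)"
    using invariance P g by (simp add: invariance_property_def)
  moreover have "g \<otimes> h \<otimes> inv g \<in> g <# fam_Inter G (fam_restrict \<A> P) #> inv g"
    using h by (auto simp: l_coset_def r_coset_def)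
  ultimately show ?thesis by simp
qed

text \<open>This is invariance for \<open>P = S\<close>, since all members lie in \<open>S\<close>
  and \<open>S\<close> normalizes itself.\<close>

lemma I_conj:
  assumes "g \<in> S" "h \<in> I"
  shows "g \<otimes> h \<otimes> inv g \<in> I"
proof -
  have S: "S \<lhd> G\<lparr>carrier := S\<rparr>"
    using normal_restrict_iff[OF subgroup_S] subgroup_S subgroup.m_closed[OF subgroup_S]
      subgroup.m_inv_closed[OF subgroup_S] by simp
  have "g \<otimes> s \<otimes> inv g \<in> S" if "s \<in> S" for s
    using that assms(1) subgroup.m_closed[OF subgroup_S] subgroup.m_inv_closed[OF subgroup_S] by simp
  hence "g \<in> normalizer G S"
    using normalizer_iff[OF S_carrier] conj_subset_imp_eq[OF finite_S S_carrier S_carrier]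
      finite_S assms(1) S_carrier by auto
  moreover have "fam_restrict \<A> S = \<A>" using member(2) by (auto simp: fam_restrict_def)
  ultimately show ?thesis
    using fam_Inter_restrict_conj[OF S, of g h] nonempty assms(2) by (simp add: fam_Inter_def)
qed

lemma I_subset_p_core: "I \<subseteq> p_core p G"
proof
  let ?P = "p_core p G"
  have P: "normal_p_subgroup p ?P G" using p_core_greatest(1)[OF p is_group fin] .
  have nP: "?P \<lhd> G" using normal_p_subgroupD(1)[OF P] .
  obtain m where m: "card S * m = order G" "\<not> p dvd m" using sylow_index by blast
  have PS: "?P \<subseteq> S" by (rule normal_p_subgroup_subset_sylow[OF p fin subgroup_S m P])
  let ?L = "action_p_core p G (G\<lparr>carrier := ?P\<rparr>) (conj_action G ?P)"
  obtain k where k: "card ?L = card (centralizer G ?P) * p ^ k"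
    using action_p_core_conj(3)[OF p fin nP] by blast
  have "subgroup (centralizer G ?P) G"
    using normal_imp_subgroup[OF normal_centralizer[OF nP]] .
  \<comment> \<open>The centralizer has p-power order because it lies in the p-core. Hence so does
    \<open>?L\<close>, which is therefore contained in the p-core.\<close>
  hence "card (centralizer G ?P) dvd card ?P"
    using lagrange_subgroup[OF _ normal_imp_subgroup[OF nP] centralizer_core] by simp
  moreover obtain n where "card ?P = p ^ n" using normal_p_subgroupD(2)[OF P] by blast
  ultimately obtain j where "card (centralizer G ?P) = p ^ j"
    using p divides_primepow_nat by metis
  hence "card ?L = p ^ (j + k)" using k by (simp add: power_add)
  hence LP: "?L \<subseteq> ?P"
    using p_core_greatest(2)[OF p is_group fin]
      normal_p_subgroupI[OF action_p_core_conj(1)[OF p fin nP]] by blast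
  fix x assume x: "x \<in> I"
  have "acts_quadratically G (G\<lparr>carrier := ?P\<rparr>) (conj_action G ?P) x"
  proof (rule acts_quadraticallyI[OF nP subgroup_I x I_commute[OF x]])
    fix w assume "w \<in> ?P"
    hence w: "w \<in> S" using PS by blast
    thus "inv w \<otimes> x \<otimes> w \<in> I"
      using I_conj[OF subgroup.m_inv_closed[OF subgroup_S w] x] S_carrier by (simp add: subset_iff)
  qed
  hence "x \<in> ?L"
    using p_stable[OF P] x I_subset_S S_carrier unfolding p_stable_action_def by blast
  thus "x \<in> ?P" using LP by blast
qed

text \<open>The witness is \<open>W \<inter> B\<close>, where \<open>W\<close> intersects the
  members of \<open>\<A>\<close> inside \<open>K\<close>. It lies in \<open>A\<close> because
  quadratic action places \<open>A\<close> itself among those members.\<close>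

lemma normal_between:
  assumes B: "normal_p_subgroup p B G" and A: "A \<in> \<A>" "B \<subseteq> normalizer G A"
  shows "\<exists>M. M \<lhd> G \<and> I \<inter> B \<subseteq> M \<and> M \<subseteq> A"
proof -
  have nB: "B \<lhd> G" using normal_p_subgroupD(1)[OF B] .
  interpret B: normal B G by fact
  define L where "L = action_p_core p G (G\<lparr>carrier := B\<rparr>) (conj_action G B)"
  define C where "C = centralizer G B"
  define K where "K = L \<inter> S"
  have L: "L \<lhd> G" "C \<subseteq> L" "\<exists>k. card L = card C * p ^ k"
    using action_p_core_conj[OF p fin nB] by (auto simp: L_def C_def)
  then obtain k where k: "card L = card C * p ^ k" by blast
  have nC: "C \<lhd> G" unfolding C_def by (rule normal_centralizer[OF nB])
  have sK: "subgroup K G"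
    unfolding K_def by (rule subgroups_Inter_pair[OF normal_imp_subgroup[OF L(1)] subgroup_S])
  have nK: "K \<lhd> G\<lparr>carrier := S\<rparr>"
    unfolding K_def by (rule normal_Int_subgroup[OF subgroup_S L(1)])
  obtain m where m: "card S * m = order G" "\<not> p dvd m" using sylow_index by blast
  obtain m' where m': "card K * m' = card L" "m' dvd m"
    using index_Int_normal[OF L(1) subgroup_S m(1) fin] by (auto simp: K_def)
  have pm': "\<not> p dvd m'" using m(2) m'(2) dvd_trans by blast
  have "card K dvd card S"
    using lagrange_subgroup[OF sK subgroup_S] by (simp add: K_def)
  then obtain a where a: "card K = p ^ a"
    using sylow p divides_primepow_nat by (auto simp: sylow_subgroup_def)
  have AL: "A \<subseteq> L"
  proof
    fix x assume x: "x \<in> A"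
    have Ac: "A \<subseteq> carrier G" using subgroup.subset[OF member(1)[OF A(1)]] .
    have "acts_quadratically G (G\<lparr>carrier := B\<rparr>) (conj_action G B) x"
    proof (rule acts_quadraticallyI[OF nB member(1)[OF A(1)] x member(3)[OF A(1) x]])
      fix w assume w: "w \<in> B"
      hence "inv w \<in> normalizer G A" using A(2) by blast
      thus "inv w \<otimes> x \<otimes> w \<in> A"
        using normalizer_conjD[OF Ac _ x, of "inv w"] w by simp
    qed
    thus "x \<in> L"
      using p_stable[OF B] x Ac unfolding p_stable_action_def L_def by blast
  qed
  hence AK: "A \<in> fam_restrict \<A> K"
    using A(1) member(2) by (auto simp: fam_restrict_def K_def)
  define W where "W = fam_Inter G (fam_restrict \<A> K)"
  have W: "W = \<Inter>(fam_restrict \<A> K)" using AK by (auto simp: W_def fam_Inter_def)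
  have "W \<inter> B \<lhd> G"
  proof (rule normal_invI)
    have "subgroup W G"
      unfolding W_def using member(1) by (auto simp: fam_restrict_def intro!: fam_Inter_subgroup)
    thus "subgroup (W \<inter> B) G" using subgroups_Inter_pair B.subgroup_axioms by blast
    fix g h assume g: "g \<in> carrier G" and h: "h \<in> W \<inter> B"
    \<comment> \<open>Conjugation by \<open>n\<close> preserves \<open>W\<close> by invariance, and
      conjugation by \<open>c\<close> fixes \<open>B\<close> pointwise.\<close>
    obtain c n where cn: "c \<in> C" "n \<in> normalizer G K" "g = c \<otimes> n"
      using frattini_factorization[OF p fin L(1) nC L(2) k sK _ a m'(1) pm' g]
      by (auto simp: K_def)
    have nc: "n \<in> carrier G"
      using cn(2) normalizer_iff[OF subgroup.subset[OF sK]] by blast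
    have cc: "c \<in> carrier G" using cn(1) by (simp add: C_def centralizer_def)
    have hc: "h \<in> carrier G" using h B.mem_carrier by simp
    let ?h = "n \<otimes> h \<otimes> inv n"
    have "?h \<in> W"
      using fam_Inter_restrict_conj[OF nK cn(2)] h by (simp add: W_def)
    moreover have hB: "?h \<in> B" using B.inv_op_closed2[OF nc] h by blast
    moreover have "c \<otimes> ?h = ?h \<otimes> c" using cn(1) hB by (simp add: C_def centralizer_def)
    hence "c \<otimes> ?h \<otimes> inv c = ?h" using cc nc hc by (simp add: inv_solve_right')
    moreover have "g \<otimes> h \<otimes> inv g = c \<otimes> ?h \<otimes> inv c"
      using cc nc hc cn(3) by (simp add: m_assoc inv_mult_group)
    ultimately show "g \<otimes> h \<otimes> inv g \<in> W \<inter> B" by simp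
  qed
  moreover have "I \<inter> B \<subseteq> W \<inter> B" unfolding W by (auto simp: fam_restrict_def)
  moreover have "W \<inter> B \<subseteq> A" unfolding W using AK by blast
  ultimately show ?thesis by blast
qed

lemma I_Int_normal:
  assumes "normal_p_subgroup p B G"
  shows "I \<inter> B \<lhd> G"
  using assms
proof (induction "card B" arbitrary: B rule: less_induct)
  case less
  note B = less.prems
  have nB: "B \<lhd> G" using normal_p_subgroupD(1)[OF B] .
  interpret B: normal B G by fact
  have finB: "finite B" using finite_subset[OF B.subset fin] .
  obtain m where m: "card S * m = order G" "\<not> p dvd m" using sylow_index by blast
  have BS: "B \<subseteq> S" by (rule normal_p_subgroup_subset_sylow[OF p fin subgroup_S m B])
  obtain n where n: "card B = p ^ n" using normal_p_subgroupD(2)[OF B] by blast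
  \<comment> \<open>The induction hypothesis: subgroups of \<open>B\<close> again have p-power
    order.\<close>
  have smaller: "I \<inter> M \<lhd> G" if M: "M \<lhd> G" "M \<subset> B" for M
  proof (rule less.hyps)
    show "card M < card B" using psubset_card_mono[OF finB M(2)] .
    have "card M dvd p ^ n"
      using lagrange_subgroup[OF normal_imp_subgroup[OF M(1)] B.subgroup_axioms] M(2) n by auto
    then obtain i where "card M = p ^ i" using p divides_primepow_nat by blast
    thus "normal_p_subgroup p M G" using normal_p_subgroupI[OF M(1)] by blast
  qed
  show ?case
  proof (rule ccontr)
    assume not_normal: "\<not> ?case"
    \<comment> \<open>Otherwise \<open>M \<inter> B\<close> is a smaller normal p-subgroup with the
      same intersection with \<open>I\<close>.\<close>
    have closure: "B \<subseteq> M" if M: "M \<lhd> G" "I \<inter> B \<subseteq> M" for M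
    proof (rule ccontr)
      assume "\<not> B \<subseteq> M"
      hence "I \<inter> (M \<inter> B) \<lhd> G"
        using smaller[of "M \<inter> B"] normal_subgroup_intersect[OF M(1) nB] by blast
      moreover have "I \<inter> (M \<inter> B) = I \<inter> B" using M(2) by blast
      ultimately show False using not_normal by simp
    qed
    \<comment> \<open>A nontrivial \<open>B\<close> is needed for
      \<open>derived_proper\<close>.\<close>
    have "n \<noteq> 0"
    proof
      assume "n = 0"
      then obtain b where "B = {b}" using n by (auto simp: card_1_singleton_iff)
      hence "B = {\<one>}" using B.one_closed by blast
      hence "I \<inter> B = {\<one>}" using subgroup.one_closed[OF subgroup_I] by blast
      thus False using not_normal one_is_normal by simp
    qed
    then obtain n' where n': "n = Suc n'" by (cases n) auto
    define D where "D = derived G B"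
    have nD: "D \<lhd> G" unfolding D_def by (rule derived_is_normal[OF nB])
    have "D \<subset> B"
      using group.derived_proper[OF subgroup_imp_group[OF B.subgroup_axioms] p, of n'] n n'
        derived_consistent[OF order_refl B.subgroup_axioms]
        derived_incl[OF order_refl B.subgroup_axioms]
      by (auto simp: order_def D_def)
    define N where "N = I \<inter> D"
    have nN: "N \<lhd> G" unfolding N_def by (rule smaller[OF nD \<open>D \<subset> B\<close>])
    \<comment> \<open>By \<open>closure\<close> only elements of \<open>I \<inter> B\<close> need
      checking. Their commutators with \<open>B\<close> lie in \<open>D\<close>, and also in
      \<open>I\<close>, because \<open>B\<close> lies in \<open>S\<close> and so normalizes
      \<open>I\<close>.\<close>
    have "B \<subseteq> commutes_mod N B"
    proof (rule closure[OF normal_commutes_mod[OF nN nB]], rule subsetI)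
      fix z assume z: "z \<in> I \<inter> B"
      have "z \<otimes> h \<otimes> inv z \<otimes> inv h \<in> N" if h: "h \<in> B" for h
      proof -
        have "h \<otimes> inv z \<otimes> inv h \<in> I"
          using I_conj[of h "inv z"] z h BS subgroup.m_inv_closed[OF subgroup_I, of z] by blast
        hence "z \<otimes> (h \<otimes> inv z \<otimes> inv h) \<in> I"
          using z subgroup.m_closed[OF subgroup_I, of z] by blast
        hence "z \<otimes> h \<otimes> inv z \<otimes> inv h \<in> I" using z h by (simp add: m_assoc)
        moreover have "z \<otimes> h \<otimes> inv z \<otimes> inv h \<in> D"
          unfolding D_def derived_def by (rule generate.incl) (use z h in blast)
        ultimately show ?thesis by (simp add: N_def)
      qed
      thus "z \<in> commutes_mod N B" using z by (simp add: commutes_mod_def)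
    qed
    hence "derived_set G B \<subseteq> N" by (auto simp: commutes_mod_def)
    hence "D \<subseteq> N"
      unfolding D_def derived_def by (rule generate_subgroup_incl[OF _ normal_imp_subgroup[OF nN]])
    hence DI: "D \<subseteq> I" by (simp add: N_def)
    \<comment> \<open>Again by \<open>closure\<close>: \<open>I\<close> is abelian and contains
      \<open>D\<close>.\<close>
    have "B \<subseteq> centralizer G D"
    proof (rule closure[OF normal_centralizer[OF nD]], rule subsetI)
      fix z assume z: "z \<in> I \<inter> B"
      thus "z \<in> centralizer G D"
        using DI I_commute[of z] by (simp add: centralizer_def subset_iff)
    qed
    hence class2: "nilpotency_class_le (G\<lparr>carrier := B\<rparr>) 2"
      using nilpotency_class_le_2I[OF B.subgroup_axioms] by (simp add: D_def)
    have "\<not> B \<subseteq> I"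
    proof
      assume "B \<subseteq> I"
      hence "I \<inter> B = B" by blast
      thus False using not_normal nB by simp
    qed
    then obtain A\<^sub>0 where "A\<^sub>0 \<in> \<A>" "\<not> B \<subseteq> A\<^sub>0" by blast
    moreover have "derived G B \<subseteq> A" if "A \<in> \<A>" for A
      using DI that by (auto simp: D_def)
    moreover have "B \<lhd> G\<lparr>carrier := S\<rparr>" by (rule normal_restrict_supergroup[OF subgroup_S nB BS])
    ultimately obtain A where A: "A \<in> \<A>" "\<not> B \<subseteq> A" "B \<subseteq> normalizer G A"
      using replacement class2 unfolding replacement_property_def by blast
    \<comment> \<open>\<open>closure\<close> forces \<open>B\<close> into \<open>M\<close>, hence
      into \<open>A\<close>, against the choice of \<open>A\<close>.\<close>
    obtain M where M: "M \<lhd> G" "I \<inter> B \<subseteq> M" "M \<subseteq> A"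
      using normal_between[OF B A(1,3)] by blast
    show False using closure[OF M(1,2)] M(3) A(2) by blast
  qed
qed

lemma I_normal: "I \<lhd> G"
  using I_Int_normal[OF p_core_greatest(1)[OF p is_group fin]] I_subset_p_core
  by (simp add: Int_absorb2)

end

section \<open>From characteristic in a Sylow subgroup to characteristic in the group\<close>

lemma (in group) normal_characteristic_sylow_imp_characteristic:
  assumes p: "Factorial_Ring.prime p" and fin: "finite (carrier G)"
    and S: "sylow_subgroup p S G"
    and H: "H \<lhd> G" "characteristic H (G\<lparr>carrier := S\<rparr>)"
  shows "characteristic H G"
  unfolding characteristic_def
proof (intro conjI ballI)
  interpret H: normal H G by fact
  show "subgroup H G" by (rule H.subgroup_axioms)
  fix \<alpha> assume \<alpha>: "\<alpha> \<in> auto G"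
  have sS: "subgroup S G" using S by (simp add: sylow_subgroup_def)
  have Sc: "S \<subseteq> carrier G" using subgroup.subset[OF sS] .
  have finS: "finite S" using finite_subset[OF Sc fin] .
  have HS: "H \<subseteq> S"
    using H(2) subgroup.subset[of H "G\<lparr>carrier := S\<rparr>"] by (simp add: characteristic_def)
  have hom: "\<alpha> \<in> hom G G" and bij: "bij_betw \<alpha> (carrier G) (carrier G)"
    using \<alpha> by (auto simp: auto_def Bij_def)
  have inj: "inj_on \<alpha> (carrier G)" using bij bij_betw_def by blast
  have \<alpha>c: "\<alpha> x \<in> carrier G" if "x \<in> carrier G" for x using hom_in_carrier[OF hom that] .
  have "group_hom G G \<alpha>" by (simp add: group_hom_def group_hom_axioms_def is_group hom)
  hence sub: "subgroup (\<alpha> ` S) G" using group_hom.subgroup_img_is_subgroup[OF _ sS] by blast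
  have card: "card (\<alpha> ` S) = p ^ multiplicity p (order G)"
    using S card_image[OF inj_on_subset[OF inj Sc]] by (simp add: sylow_subgroup_def)
  obtain m where "card S * m = order G" "\<not> p dvd m"
    using sylow_subgroup_index[OF p fin S] by blast
  then obtain g where g: "g \<in> carrier G" "\<And>x. x \<in> \<alpha> ` S \<Longrightarrow> g \<otimes> x \<otimes> inv g \<in> S"
    using p_subgroup_conj_subset[OF p fin sub card sS] by blast
  define \<beta> where "\<beta> = (\<lambda>x\<in>S. g \<otimes> \<alpha> x \<otimes> inv g)"
  have \<beta>S: "\<beta> x \<in> S" if "x \<in> S" for x using g that by (simp add: \<beta>_def)
  have "inj_on \<beta> S"
  proof (rule inj_onI)
    fix x y assume xy: "x \<in> S" "y \<in> S" "\<beta> x = \<beta> y"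
    hence "\<alpha> x = \<alpha> y" using g(1) \<alpha>c Sc by (simp add: \<beta>_def subset_iff)
    thus "x = y" using xy inj Sc by (auto simp: inj_on_def)
  qed
  hence "bij_betw \<beta> S S"
    using \<beta>S endo_inj_surj[OF finS, of \<beta>] by (auto simp: bij_betw_def)
  moreover have "\<beta> \<in> hom (G\<lparr>carrier := S\<rparr>) (G\<lparr>carrier := S\<rparr>)"
  proof (rule homI)
    fix x y assume "x \<in> carrier (G\<lparr>carrier := S\<rparr>)" "y \<in> carrier (G\<lparr>carrier := S\<rparr>)"
    hence xy: "x \<in> S" "y \<in> S" "x \<in> carrier G" "y \<in> carrier G" using Sc by auto
    hence "\<alpha> (x \<otimes> y) = \<alpha> x \<otimes> \<alpha> y" using hom_mult[OF hom] by blast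
    thus "\<beta> (x \<otimes>\<^bsub>G\<lparr>carrier := S\<rparr>\<^esub> y) = \<beta> x \<otimes>\<^bsub>G\<lparr>carrier := S\<rparr>\<^esub> \<beta> y"
      using xy g(1) \<alpha>c subgroup.m_closed[OF sS] by (simp add: \<beta>_def m_assoc)
  qed (use \<beta>S in simp)
  ultimately have "\<beta> \<in> auto (G\<lparr>carrier := S\<rparr>)"
    by (simp add: auto_def Bij_def \<beta>_def)
  hence \<beta>H: "\<beta> ` H = H" using H(2) by (simp add: characteristic_def)
  have "\<alpha> x \<in> H" if x: "x \<in> H" for x
  proof -
    have "\<beta> x \<in> H" using imageI[OF x, of \<beta>] \<beta>H by simp
    hence "g \<otimes> \<alpha> x \<otimes> inv g \<in> H" using subsetD[OF HS x] by (simp add: \<beta>_def)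
    \<comment> \<open>Normality of \<open>H\<close> undoes the conjugation by
      \<open>g\<close>.\<close>
    hence "inv g \<otimes> (g \<otimes> \<alpha> x \<otimes> inv g) \<otimes> g \<in> H" using H.inv_op_closed1[OF g(1)] by blast
    thus ?thesis using g(1) \<alpha>c x by (simp add: m_assoc)
  qed
  hence "\<alpha> ` H \<subseteq> H" by blast
  thus "\<alpha> ` H = H"
    by (rule endo_inj_surj[OF finite_subset[OF H.subset fin] _ inj_on_subset[OF inj H.subset]])
qed

theorem theorem1p1:
  fixes p :: nat and G :: "('a, 'b) monoid_scheme" and S :: "'a set" and \<A> :: "'a set set"
  assumes "Factorial_Ring.prime p"
    and "group G" and "finite (carrier G)"
    and "sylow_subgroup p S G"
    and "centralizer G (p_core p G) \<subseteq> p_core p G"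
    and "\<forall>P. normal_p_subgroup p P G \<longrightarrow>
           p_stable_action p G (G\<lparr>carrier := P\<rparr>) (conj_action G P)"
    and "abelian_subgroups_of G S \<A>"
    and "invariance_property G S \<A>"
    and "replacement_property G S \<A>"
  shows "fam_Inter G \<A> \<lhd> G \<and>
         (characteristic (fam_Inter G \<A>) (G\<lparr>carrier := S\<rparr>) \<longrightarrow>
          characteristic (fam_Inter G \<A>) G)"
proof -
  interpret group G by fact
  have normal: "fam_Inter G \<A> \<lhd> G"
  proof (cases "\<A> = {}")
    case True
    thus ?thesis using one_is_normal by (simp add: fam_Inter_def)
  next
    case False
    interpret invariant_replacement_family G p S \<A>
      by unfold_locales (use assms False in auto)
    show ?thesis using I_normal False by (simp add: fam_Inter_def)
  qed
  thus ?thesis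
    using normal_characteristic_sylow_imp_characteristic[OF assms(1,3,4)] by blast
qed

end
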